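(* The cost $\mathfrak C_d$ of assembling the matrix $\mathtt A=[\mathtt a(\phi_n,\psi_m)]_{n=1,\dots,N}^{m=1,\dots,M}$ by the recursive sum factorization algorithm described in the context satisfies $$\mathfrak C_d\lesssim \sum_{i=1}^d p_i q_i \Big(\prod_{\delta=i}^{d} \#\mathbb X_\delta\Big)\Big(\prod_{\delta=1}^{i-1}(q_\delta N_\delta+p_\delta M_\delta)\Big)\le \Big(\sum_{i=1}^d p_iq_i\Big)\,\#\mathbb X_d\prod_{\delta=1}^{d-1}\max\{\#\mathbb X_\delta,\;q_\delta N_\delta+p_\delta M_\delta\}.$$ Consequently, with $p:=\max\{p_1,\dots,p_d,q_1,\dots,q_d\}$ and assuming $M_\delta\lesssim N_\delta$ for all $\delta=1,\dots,d$: 1. if $\#\mathbb X_\delta\lesssim q_\delta N_\delta+p_\delta M_\delta$ for all $\delta$, then $\mathfrak C_d\lesssim p^{d+2}N$; 2. if $\#\mathbb X_\delta\lesssim N_\delta$ for all $\delta$, then $\mathfrak C_d\lesssim p^{d+1}N$; 3. if $\#\mathbb X_\delta\gtrsim q_\delta N_\delta+p_\delta M_\delta$ for all $\delta$, then $\mathfrak C_d\lesssim p^2\,\#\mathbb X$.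
   Context: Tensor-product setting. For each direction $\delta=1,\dots,d$ let $\Phi_\delta=(\phi^{(\delta)}_n)_{n=1}^{N_\delta}$ and $\Psi_\delta=(\psi^{(\delta)}_m)_{m=1}^{M_\delta}$ be finite families of univariate real functions (not necessarily linearly independent), $\mathbb X_\delta\subset\mathbb R$ a finite set of quadrature points and $\omega_\delta:\mathbb X_\delta\to\mathbb R$ weights. Put $N=\prod_\delta N_\delta$, $M=\prod_\delta M_\delta$, $\mathbb X=\mathbb X_1\times\dots\times\mathbb X_d$, $\omega(\mathbf x)=\prod_\delta\omega_\delta(x_\delta)$. The families $\Phi=(\phi_n)_{n=1}^N$, $\Psi=(\psi_m)_{m=1}^M$ consist of all products $\phi_n(\mathbf x)=\prod_\delta\phi^{(\delta)}_{n_\delta}(x_\delta)$ and $\psi_m(\mathbf x)=\prod_\delta\psi^{(\delta)}_{m_\delta}(x_\delta)$, where $n\leftrightarrow(n_1,\dots,n_d)$ and $m\leftrightarrow(m_1,\dots,m_d)$ are the lexicographic orderings (first index running fastest). For a given coefficient $\mathcal F:\mathbb X\to\mathbb R$ set $\mathtt a(\phi,\psi)=\sum_{\mathbf x\in\mathbb X}\omega(\mathbf x)\mathcal F(\mathbf x)\phi(\mathbf x)\psi(\mathbf x)$. Overlap parameters. $\mathrm{csupp}\,\phi:=\{\alpha\mathbf x+(1-\alpha)\mathbf y:\phi(\mathbf x)\ne0,\phi(\mathbf y)\neq 0,\alpha\in[0,1]\}$, $p_\delta=\max_{x\in\mathbb X_\delta}\#\{\phi\in\Phi_\delta:x\in\mathrm{csupp}\,\phi\}$,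 $q_\delta=\max_{x\in\mathbb X_\delta}\#\{\psi\in\Psi_\delta:x\in\mathrm{csupp}\,\psi\}$. Algorithm ASSEMBLE$_d$ (input: $\mathbb X_\delta,\omega_\delta,\Phi_\delta,\Psi_\delta$ for $\delta\le d$, and the values of $\mathcal F$ on $\mathbb X$). If $d=0$, return the single value of $\mathcal F$. Otherwise start from the zero matrix $\mathtt A$, viewed as an $M_d\times N_d$ array of blocks $B_{m_d,n_d}$, each of size $\prod_{\delta<d}M_\delta\times\prod_{\delta<d}N_\delta$. For each $x_d\in\mathbb X_d$: compute recursively the matrix $\mathtt A_{x_d}$ by ASSEMBLE$_{d-1}$ applied to the first $d-1$ directions and the coefficient $\mathcal F(\cdot,x_d)$; then, for all $n_d$ with $\phi^{(d)}_{n_d}(x_d)\ne0$ and all $m_d$ with $\psi^{(d)}_{m_d}(x_d)\neq0$, update $B_{m_d,n_d}\leftarrow B_{m_d,n_d}+\omega_d(x_d)\phi^{(d)}_{n_d}(x_d)\psi^{(d)}_{m_d}(x_d)\,\mathtt A_{x_d}$. Return $\mathtt A$. Cost. All values of $\mathcal F$, $\omega_\delta$, $\phi^{(\delta)}_n$, $\psi^{(\delta)}_m$ at quadrature points are assumed available and their evaluation is not counted. The cost $\mathfrak C_d$ is the total number of scalar entry updates performed in all block updates, over all recursion levels, where one update by a matrix $\mathtt A_{x_d}$ costs its number of non-zero entries. Notation: $a\lesssim b$ means $a\le c\,b$ with a constant $c>0$ independent of all $p_\delta,q_\delta,N_\delta,M_\delta,\mathbb X_\delta$ but possibly depending on $d$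 (and, in implications, on the constants in the hypotheses); $a\gtrsim b$ means $b\lesssim a$. $\#T$ is the number of elements of $T$. *)

theory Defs
  imports "Jordan_Normal_Form.Matrix" "HOL-Library.FuncSet"
begin

text \<open>
  Directions are numbered from 1 to d. Per direction, the quadrature points are a set of reals
  and a family of univariate functions is a list, so that repeated members are counted with
  multiplicity. Members of families, and rows and columns of matrices, are numbered from 0.
  A point of the product grid is a function in \<open>PiE {1..d} X\<close>.
\<close>

definition csupp :: "('a::real_vector \<Rightarrow> real) \<Rightarrow> 'a set" where
  "csupp f = {\<alpha> *\<^sub>R x + (1 - \<alpha>) *\<^sub>R y | \<alpha> x y. f x \<noteq> 0 \<and> f y \<noteq> 0 \<and> \<alpha> \<in> {0..1}}"

text \<open>On natural numbers, \<open>SUP\<close> over a nonempty finite set is the maximum; over the empty set it is 0.\<close>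

definition overlap :: "real set \<Rightarrow> (real \<Rightarrow> real) list \<Rightarrow> nat" where
  "overlap X fs = (SUP x\<in>X. card {n. n < length fs \<and> x \<in> csupp (fs ! n)})"

definition max_overlap ::
  "nat \<Rightarrow> (nat \<Rightarrow> real set) \<Rightarrow> (nat \<Rightarrow> (real \<Rightarrow> real) list) \<Rightarrow> (nat \<Rightarrow> (real \<Rightarrow> real) list) \<Rightarrow> nat" where
  "max_overlap d X \<Phi> \<Psi> =
     Max ((\<lambda>\<delta>. overlap (X \<delta>) (\<Phi> \<delta>)) ` {1..d} \<union> (\<lambda>\<delta>. overlap (X \<delta>) (\<Psi> \<delta>)) ` {1..d})"

definition family_size :: "nat \<Rightarrow> (nat \<Rightarrow> (real \<Rightarrow> real) list) \<Rightarrow> nat" where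
  "family_size d \<Phi> = (\<Prod>\<delta>=1..d. length (\<Phi> \<delta>))"

text \<open>
  The multi-index of \<open>n < family_size d \<Phi>\<close> in the lexicographic ordering with the first index
  running fastest: \<open>n\<close> is the sum of \<open>lex_index \<Phi> n \<delta> * family_size (\<delta> - 1) \<Phi>\<close> over the
  directions \<open>\<delta>\<close>.
\<close>

definition lex_index :: "(nat \<Rightarrow> (real \<Rightarrow> real) list) \<Rightarrow> nat \<Rightarrow> nat \<Rightarrow> nat" where
  "lex_index \<Phi> n \<delta> = n div family_size (\<delta> - 1) \<Phi> mod length (\<Phi> \<delta>)"

definition tensor_fun :: "nat \<Rightarrow> (nat \<Rightarrow> (real \<Rightarrow> real) list) \<Rightarrow> nat \<Rightarrow> (nat \<Rightarrow> real) \<Rightarrow> real" where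
  "tensor_fun d \<Phi> n x = (\<Prod>\<delta>=1..d. (\<Phi> \<delta> ! lex_index \<Phi> n \<delta>) (x \<delta>))"

definition quad_form ::
  "nat \<Rightarrow> (nat \<Rightarrow> real set) \<Rightarrow> (nat \<Rightarrow> real \<Rightarrow> real) \<Rightarrow> ((nat \<Rightarrow> real) \<Rightarrow> real) \<Rightarrow>
   ((nat \<Rightarrow> real) \<Rightarrow> real) \<Rightarrow> ((nat \<Rightarrow> real) \<Rightarrow> real) \<Rightarrow> real" where
  "quad_form d X \<omega> F f g = (\<Sum>x\<in>PiE {1..d} X. (\<Prod>\<delta>=1..d. \<omega> \<delta> (x \<delta>)) * F x * f x * g x)"

definition system_matrix ::
  "nat \<Rightarrow> (nat \<Rightarrow> real set) \<Rightarrow> (nat \<Rightarrow> real \<Rightarrow> real) \<Rightarrow> (nat \<Rightarrow> (real \<Rightarrow> real) list) \<Rightarrow>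
   (nat \<Rightarrow> (real \<Rightarrow> real) list) \<Rightarrow> ((nat \<Rightarrow> real) \<Rightarrow> real) \<Rightarrow> real mat" where
  "system_matrix d X \<omega> \<Phi> \<Psi> F =
     mat (family_size d \<Psi>) (family_size d \<Phi>)
       (\<lambda>(m, n). quad_form d X \<omega> F (tensor_fun d \<Phi> n) (tensor_fun d \<Psi> m))"

definition nnz :: "real mat \<Rightarrow> nat" where
  "nnz B = card {(i, j). i < dim_row B \<and> j < dim_col B \<and> B $$ (i, j) \<noteq> 0}"

text \<open>
  \<open>A\<close> is viewed as an array of blocks of the size of \<open>B\<close>; the multiple \<open>c\<close> of \<open>B\<close> is added to
  the block in block row \<open>m\<close> and block column \<open>n\<close>.
\<close>

definition block_update :: "nat \<Rightarrow> nat \<Rightarrow> real \<Rightarrow> real mat \<Rightarrow> real mat \<Rightarrow> real mat" where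
  "block_update m n c B A = mat (dim_row A) (dim_col A) (\<lambda>(i, j).
     if i div dim_row B = m \<and> j div dim_col B = n
     then A $$ (i, j) + c * B $$ (i mod dim_row B, j mod dim_col B)
     else A $$ (i, j))"

text \<open>
  The state consists of the matrix and the number of scalar entry updates so far. The quadrature
  points are visited in increasing order. For \<open>d = 0\<close> the grid has the single point
  \<open>\<lambda>_. undefined\<close>.
\<close>

fun assemble ::
  "nat \<Rightarrow> (nat \<Rightarrow> real set) \<Rightarrow> (nat \<Rightarrow> real \<Rightarrow> real) \<Rightarrow> (nat \<Rightarrow> (real \<Rightarrow> real) list) \<Rightarrow>
   (nat \<Rightarrow> (real \<Rightarrow> real) list) \<Rightarrow> ((nat \<Rightarrow> real) \<Rightarrow> real) \<Rightarrow> real mat \<times> nat" where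
  "assemble 0 X \<omega> \<Phi> \<Psi> F = (mat 1 1 (\<lambda>_. F (\<lambda>_. undefined)), 0)"
| "assemble (Suc d) X \<omega> \<Phi> \<Psi> F =
     fold (\<lambda>x (A, k).
       let (A\<^sub>x, k\<^sub>x) = assemble d X \<omega> \<Phi> \<Psi> (\<lambda>y. F (y(Suc d := x)));
           ns = filter (\<lambda>n. (\<Phi> (Suc d) ! n) x \<noteq> 0) [0..<length (\<Phi> (Suc d))];
           ms = filter (\<lambda>m. (\<Psi> (Suc d) ! m) x \<noteq> 0) [0..<length (\<Psi> (Suc d))]
       in fold (\<lambda>(n, m) (A, k).
            (block_update m n (\<omega> (Suc d) x * (\<Phi> (Suc d) ! n) x * (\<Psi> (Suc d) ! m) x) A\<^sub>x A,
             k + nnz A\<^sub>x))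
          (List.product ns ms) (A, k + k\<^sub>x))
     (sorted_list_of_set (X (Suc d)))
     (0\<^sub>m (family_size (Suc d) \<Psi>) (family_size (Suc d) \<Phi>), 0)"

definition assembled_matrix ::
  "nat \<Rightarrow> (nat \<Rightarrow> real set) \<Rightarrow> (nat \<Rightarrow> real \<Rightarrow> real) \<Rightarrow> (nat \<Rightarrow> (real \<Rightarrow> real) list) \<Rightarrow>
   (nat \<Rightarrow> (real \<Rightarrow> real) list) \<Rightarrow> ((nat \<Rightarrow> real) \<Rightarrow> real) \<Rightarrow> real mat" where
  "assembled_matrix d X \<omega> \<Phi> \<Psi> F = fst (assemble d X \<omega> \<Phi> \<Psi> F)"

definition assembly_cost ::
  "nat \<Rightarrow> (nat \<Rightarrow> real set) \<Rightarrow> (nat \<Rightarrow> real \<Rightarrow> real) \<Rightarrow> (nat \<Rightarrow> (real \<Rightarrow> real) list) \<Rightarrow>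
   (nat \<Rightarrow> (real \<Rightarrow> real) list) \<Rightarrow> ((nat \<Rightarrow> real) \<Rightarrow> real) \<Rightarrow> nat" where
  "assembly_cost d X \<omega> \<Phi> \<Psi> F = snd (assemble d X \<omega> \<Phi> \<Psi> F)"

end

theory Submission
  imports Defs
begin

text \<open>
  The last direction is the outermost one: an index below \<open>family_size (Suc d) \<Phi>\<close> splits by
  division with remainder into the last index and the multi-index of the first \<open>d\<close> directions,
  which is exactly the block structure used by the algorithm. Correctness is then the
  distributive law: the sum over the product grid is an outer sum over the last coordinate, whose
  factors leave the inner sum, and the inner sum is the system matrix of the sliced coefficient
  (\<open>quad_form_Suc\<close>, \<open>assembled_matrix_eq\<close>).

  The cost rests on a sparsity estimate. An entry of the system matrix can be non-zero only if
  in each direction the two univariate functions are simultaneously non-zero at some quadrature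
  point. The convex supports of such an interacting pair, restricted to the quadrature points,
  are two intersecting ranges of points, so the first point of one of them lies in the other. A
  pair is therefore determined by one of its functions and a choice among the functions
  overlapping at a fixed point, which gives at most \<open>q N + p M\<close> pairs per direction
  (\<open>card_interacting_le\<close>) and at most the product of these numbers of non-zero entries
  (\<open>nnz_system_matrix_le\<close>).

  In the top level of the recursion every quadrature point causes one recursive call and at most
  \<open>p q\<close> block updates, each as expensive as the number of non-zero entries of the smaller matrix.
  The resulting recursive inequality is the equality satisfied by the asserted sum
  (\<open>cost_bound_Suc\<close>), so that the first bound holds with constant 1. The remaining bounds come
  from one estimate (\<open>cost_bound_le\<close>): if both the number of points and \<open>q N + p M\<close> are at most
  \<open>u \<delta>\<close>, all products in the sum are at most the product of all \<open>u \<delta>\<close>. In the last direction only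
  the number of points matters, because no factor \<open>q N + p M\<close> occurs there; this saves
  one power of the overlap when the number of points is controlled by \<open>N\<close>.
\<close>

section \<open>Lexicographic indices\<close>

lemma family_size_0 [simp]: "family_size 0 \<Phi> = 1"
  by (simp add: family_size_def)

lemma family_size_Suc: "family_size (Suc d) \<Phi> = family_size d \<Phi> * length (\<Phi> (Suc d))"
  by (simp add: family_size_def)

lemma family_size_dvd: "e \<le> d \<Longrightarrow> family_size e \<Phi> dvd family_size d \<Phi>"
  unfolding family_size_def by (rule prod_dvd_prod_subset) auto

lemma last_index_less:
  "n < family_size (Suc d) \<Phi> \<Longrightarrow> n div family_size d \<Phi> < length (\<Phi> (Suc d))"
  by (metis family_size_Suc less_mult_imp_div_less mult.commute)

lemma lex_index_last:
  "n < family_size (Suc d) \<Phi> \<Longrightarrow> lex_index \<Phi> n (Suc d) = n div family_size d \<Phi>"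
  by (simp add: lex_index_def last_index_less)

lemma lex_index_mod:
  assumes "\<delta> \<in> {1..d}"
  shows "lex_index \<Phi> (n mod family_size d \<Phi>) \<delta> = lex_index \<Phi> n \<delta>"
proof -
  define a where "a = family_size (\<delta> - 1) \<Phi>"
  define l where "l = length (\<Phi> \<delta>)"
  have "family_size \<delta> \<Phi> = a * l"
    using assms family_size_Suc[of "\<delta> - 1" \<Phi>] by (simp add: a_def l_def)
  then obtain k where k: "family_size d \<Phi> = a * (l * k)"
    using family_size_dvd[of \<delta> d \<Phi>] assms by (metis atLeastAtMost_iff dvdE mult.assoc)
  have "(n mod (a * (l * k))) div a = (n div a) mod (l * k)"
    by (cases "a = 0") (simp_all add: mod_mult2_eq)
  then show ?thesis
    unfolding lex_index_def k a_def[symmetric] l_def[symmetric] by (simp add: mod_mod_cancel)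
qed

lemma tensor_fun_Suc:
  assumes "n < family_size (Suc d) \<Phi>"
  shows "tensor_fun (Suc d) \<Phi> n (y(Suc d := x)) =
    tensor_fun d \<Phi> (n mod family_size d \<Phi>) y * (\<Phi> (Suc d) ! (n div family_size d \<Phi>)) x"
proof -
  have "(\<Prod>\<delta>=1..d. (\<Phi> \<delta> ! lex_index \<Phi> n \<delta>) ((y(Suc d := x)) \<delta>)) =
        (\<Prod>\<delta>=1..d. (\<Phi> \<delta> ! lex_index \<Phi> (n mod family_size d \<Phi>) \<delta>) (y \<delta>))"
    by (rule prod.cong) (auto simp: lex_index_mod)
  then show ?thesis
    by (simp add: tensor_fun_def lex_index_last[OF assms])
qed

section \<open>The assembled matrix\<close>

text \<open>
  The loop over the quadrature points and the loop over the block updates of one point both have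
  this shape, so both are turned into sums by this lemma.
\<close>

lemma fold_accumulate_mat:
  assumes "\<And>x A k. x \<in> set xs \<Longrightarrow> A \<in> carrier_mat r c \<Longrightarrow>
      step x (A, k) = (mat r c (\<lambda>ij. A $$ ij + g x ij), k + t x)"
    and "A \<in> carrier_mat r c"
  shows "fold step xs (A, k :: nat) =
    (mat r c (\<lambda>ij. A $$ ij + (\<Sum>x\<leftarrow>xs. g x ij)), k + (\<Sum>x\<leftarrow>xs. t x))"
  using assms
proof (induction xs arbitrary: A k)
  case Nil
  then show ?case by (auto intro!: eq_matI)
next
  case (Cons x xs)
  let ?A = "mat r c (\<lambda>ij. A $$ ij + g x ij)"
  have "fold step (x # xs) (A, k) = fold step xs (?A, k + t x)"
    using Cons.prems by simp
  also have "\<dots> = (mat r c (\<lambda>ij. ?A $$ ij + (\<Sum>x\<leftarrow>xs. g x ij)), k + t x + (\<Sum>x\<leftarrow>xs. t x))"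
    by (rule Cons.IH) (use Cons.prems in auto)
  finally show ?case
    by (auto intro!: eq_matI simp: add.assoc)
qed

lemma fold_block_updates:
  assumes A: "A \<in> carrier_mat r s" and "distinct ps"
  shows "fold (\<lambda>(n, m) (A, k). (block_update m n (f n m) B A, k + nnz B)) ps (A, k) =
    (mat r s (\<lambda>(i, j). A $$ (i, j) +
        (if (j div dim_col B, i div dim_row B) \<in> set ps
         then f (j div dim_col B) (i div dim_row B) * B $$ (i mod dim_row B, j mod dim_col B)
         else 0)),
     k + length ps * nnz B)"
proof -
  \<comment> \<open>For a fixed entry \<open>(i, j)\<close> only the pair numbering its own block contributes, so the sum
    over the distinct pairs has at most one non-zero term.\<close>
  define g where "g = (\<lambda>(n, m) (i, j). if (n, m) = (j div dim_col B, i div dim_row B)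
    then f n m * B $$ (i mod dim_row B, j mod dim_col B) else 0)"
  have "(\<lambda>(n, m) (A, k). (block_update m n (f n m) B A, k + nnz B)) x (A', k') =
      (mat r s (\<lambda>ij. A' $$ ij + g x ij), k' + nnz B)"
    if "A' \<in> carrier_mat r s" for x A' k'
    using that by (cases x) (auto simp: block_update_def g_def intro!: eq_matI)
  note fold = fold_accumulate_mat[of ps r s _ g "\<lambda>_. nnz B", OF this A]
  have "(\<Sum>x\<leftarrow>ps. g x (i, j)) = (if (j div dim_col B, i div dim_row B) \<in> set ps
         then f (j div dim_col B) (i div dim_row B) * B $$ (i mod dim_row B, j mod dim_col B)
         else 0)" for i j
  proof -
    have "(\<Sum>x\<leftarrow>ps. g x (i, j)) = (\<Sum>x\<in>set ps. g x (i, j))"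
      using assms by (simp add: sum_list_distinct_conv_sum_set)
    also have "\<dots> = (\<Sum>x\<in>set ps. if x = (j div dim_col B, i div dim_row B)
        then f (j div dim_col B) (i div dim_row B) * B $$ (i mod dim_row B, j mod dim_col B)
        else 0)"
      by (rule sum.cong) (auto simp: g_def split: if_splits)
    finally show ?thesis by simp
  qed
  then show ?thesis
    by (subst fold) (auto simp: sum_list_triv intro!: eq_matI)
qed

definition active :: "(real \<Rightarrow> real) list \<Rightarrow> real \<Rightarrow> nat set" where
  "active fs x = {n. n < length fs \<and> (fs ! n) x \<noteq> 0}"

text \<open>
  Only indices of functions that do not vanish at \<open>x\<close> are visited, but the sum for the entries
  carries no such restriction: for the skipped indices the coefficient of the recursively
  assembled matrix is zero.
\<close>

lemma assemble_Suc:
  fixes d X \<omega> \<Phi> \<Psi> F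
  defines "sub \<equiv> \<lambda>x. assemble d X \<omega> \<Phi> \<Psi> (\<lambda>y. F (y(Suc d := x)))"
  assumes fin: "finite (X (Suc d))"
    and dim: "\<And>x. x \<in> X (Suc d) \<Longrightarrow>
      fst (sub x) \<in> carrier_mat (family_size d \<Psi>) (family_size d \<Phi>)"
  shows "assemble (Suc d) X \<omega> \<Phi> \<Psi> F =
    (mat (family_size (Suc d) \<Psi>) (family_size (Suc d) \<Phi>)
      (\<lambda>(i, j). \<Sum>x\<in>X (Suc d). \<omega> (Suc d) x * (\<Phi> (Suc d) ! (j div family_size d \<Phi>)) x *
         (\<Psi> (Suc d) ! (i div family_size d \<Psi>)) x *
         fst (sub x) $$ (i mod family_size d \<Psi>, j mod family_size d \<Phi>)),
     \<Sum>x\<in>X (Suc d). snd (sub x) +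
       card (active (\<Phi> (Suc d)) x) * card (active (\<Psi> (Suc d)) x) * nnz (fst (sub x)))"
proof -
  let ?r = "family_size (Suc d) \<Psi>" and ?s = "family_size (Suc d) \<Phi>"
  define step where "step = (\<lambda>x (A, k).
       let (A\<^sub>x, k\<^sub>x) = sub x;
           ns = filter (\<lambda>n. (\<Phi> (Suc d) ! n) x \<noteq> 0) [0..<length (\<Phi> (Suc d))];
           ms = filter (\<lambda>m. (\<Psi> (Suc d) ! m) x \<noteq> 0) [0..<length (\<Psi> (Suc d))]
       in fold (\<lambda>(n, m) (A, k).
            (block_update m n (\<omega> (Suc d) x * (\<Phi> (Suc d) ! n) x * (\<Psi> (Suc d) ! m) x) A\<^sub>x A,
             k + nnz A\<^sub>x))
          (List.product ns ms) (A, k + k\<^sub>x))"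
  define g where "g = (\<lambda>x (i, j). \<omega> (Suc d) x * (\<Phi> (Suc d) ! (j div family_size d \<Phi>)) x *
         (\<Psi> (Suc d) ! (i div family_size d \<Psi>)) x *
         fst (sub x) $$ (i mod family_size d \<Psi>, j mod family_size d \<Phi>))"
  define t where "t = (\<lambda>x. snd (sub x) +
       card (active (\<Phi> (Suc d)) x) * card (active (\<Psi> (Suc d)) x) * nnz (fst (sub x)))"
  have active: "length (filter (\<lambda>n. (fs ! n) x \<noteq> 0) [0..<length fs]) = card (active fs x)"
    for fs :: "(real \<Rightarrow> real) list" and x
    by (simp add: length_filter_conv_card active_def cong: conj_cong)
  have "step x (A, k) = (mat ?r ?s (\<lambda>ij. A $$ ij + g x ij), k + t x)"
    if x: "x \<in> set (sorted_list_of_set (X (Suc d)))" and A: "A \<in> carrier_mat ?r ?s" for x A k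
  proof -
    have x': "x \<in> X (Suc d)" using x fin by simp
    obtain B kx where B: "sub x = (B, kx)" by fastforce
    then have dimB: "dim_row B = family_size d \<Psi>" "dim_col B = family_size d \<Phi>"
      using dim[OF x'] by auto
    show ?thesis
      unfolding step_def B Let_def prod.case
      by (subst fold_block_updates[OF A])
        (auto simp: distinct_product t_def g_def B dimB active last_index_less intro!: eq_matI)
  qed
  then have "fold step (sorted_list_of_set (X (Suc d))) (0\<^sub>m ?r ?s, 0) =
      (mat ?r ?s (\<lambda>ij. 0\<^sub>m ?r ?s $$ ij + (\<Sum>x\<leftarrow>sorted_list_of_set (X (Suc d)). g x ij)),
       0 + (\<Sum>x\<leftarrow>sorted_list_of_set (X (Suc d)). t x))"
    by (rule fold_accumulate_mat) auto
  then show ?thesis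
    using fin by (auto simp: step_def sub_def g_def t_def sum_list_distinct_conv_sum_set intro!: eq_matI)
qed

text \<open>
  This is the sum factorization: a grid point is a point \<open>y\<close> of the smaller grid together with a
  last coordinate \<open>x\<close>, and all factors depending on \<open>x\<close> alone leave the sum over \<open>y\<close>.
\<close>

lemma quad_form_Suc:
  assumes "i < family_size (Suc d) \<Psi>" and "j < family_size (Suc d) \<Phi>"
  shows "quad_form (Suc d) X \<omega> F (tensor_fun (Suc d) \<Phi> j) (tensor_fun (Suc d) \<Psi> i) =
    (\<Sum>x\<in>X (Suc d). \<omega> (Suc d) x * (\<Phi> (Suc d) ! (j div family_size d \<Phi>)) x *
       (\<Psi> (Suc d) ! (i div family_size d \<Psi>)) x *
       quad_form d X \<omega> (\<lambda>y. F (y(Suc d := x)))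
         (tensor_fun d \<Phi> (j mod family_size d \<Phi>)) (tensor_fun d \<Psi> (i mod family_size d \<Psi>)))"
proof -
  define G where "G = (\<lambda>z. (\<Prod>\<delta>=1..Suc d. \<omega> \<delta> (z \<delta>)) * F z * tensor_fun (Suc d) \<Phi> j z *
    tensor_fun (Suc d) \<Psi> i z)"
  have "PiE {1..Suc d} X = (\<lambda>(x, y). y(Suc d := x)) ` (X (Suc d) \<times> PiE {1..d} X)"
    by (simp add: atLeastAtMostSuc_conv PiE_insert_eq)
  moreover have "inj_on (\<lambda>(x, y). y(Suc d := x)) (X (Suc d) \<times> PiE {1..d} X)"
    using inj_combinator[of "Suc d" "{1..d}" X] by simp
  ultimately have "(\<Sum>z\<in>PiE {1..Suc d} X. G z) =
      (\<Sum>x\<in>X (Suc d). \<Sum>y\<in>PiE {1..d} X. G (y(Suc d := x)))"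
    by (simp add: sum.reindex sum.cartesian_product case_prod_unfold)
  moreover have "(\<Prod>\<delta>=1..d. \<omega> \<delta> ((y(Suc d := x)) \<delta>)) = (\<Prod>\<delta>=1..d. \<omega> \<delta> (y \<delta>))" for x y
    by (rule prod.cong) auto
  ultimately show ?thesis
    unfolding quad_form_def
    by (simp add: G_def tensor_fun_Suc assms sum_distrib_left mult_ac)
qed

theorem assembled_matrix_eq:
  assumes "\<forall>\<delta>\<in>{1..d}. finite (X \<delta>)"
  shows "assembled_matrix d X \<omega> \<Phi> \<Psi> F = system_matrix d X \<omega> \<Phi> \<Psi> F"
  using assms
proof (induction d arbitrary: F)
  case 0
  then show ?case
    by (auto simp: assembled_matrix_def system_matrix_def quad_form_def tensor_fun_def
      intro!: eq_matI)
next
  case (Suc d)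
  have IH: "fst (assemble d X \<omega> \<Phi> \<Psi> F') = system_matrix d X \<omega> \<Phi> \<Psi> F'" for F'
    using Suc.IH[of F'] Suc.prems by (simp add: assembled_matrix_def)
  have "assembled_matrix (Suc d) X \<omega> \<Phi> \<Psi> F =
    mat (family_size (Suc d) \<Psi>) (family_size (Suc d) \<Phi>)
      (\<lambda>(i, j). \<Sum>x\<in>X (Suc d). \<omega> (Suc d) x * (\<Phi> (Suc d) ! (j div family_size d \<Phi>)) x *
         (\<Psi> (Suc d) ! (i div family_size d \<Psi>)) x *
         system_matrix d X \<omega> \<Phi> \<Psi> (\<lambda>y. F (y(Suc d := x))) $$
           (i mod family_size d \<Psi>, j mod family_size d \<Phi>))"
    unfolding assembled_matrix_def
    by (subst assemble_Suc) (use Suc.prems in \<open>auto simp: IH, simp add: system_matrix_def\<close>)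
  also have "\<dots> = system_matrix (Suc d) X \<omega> \<Phi> \<Psi> F"
  proof (rule eq_matI, goal_cases)
    case (1 i j)
    then have ij: "i < family_size (Suc d) \<Psi>" "j < family_size (Suc d) \<Phi>"
      by (simp_all add: system_matrix_def)
    then have "i mod family_size d \<Psi> < family_size d \<Psi>" "j mod family_size d \<Phi> < family_size d \<Phi>"
      by (auto simp: family_size_Suc intro!: mod_less_divisor gr0I)
    with ij show ?case
      by (simp add: system_matrix_def quad_form_Suc)
  qed (simp_all add: system_matrix_def)
  finally show ?case .
qed

section \<open>Interacting pairs and the sparsity of the system matrix\<close>

text \<open>
  In one dimension the segments between points where \<open>f\<close> does not vanish fill an interval. In this
  form it is evident that \<open>csupp f\<close> contains everything between two of its members.
\<close>

lemma csupp_real_iff: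
  fixes f :: "real \<Rightarrow> real"
  shows "z \<in> csupp f \<longleftrightarrow> (\<exists>x y. f x \<noteq> 0 \<and> f y \<noteq> 0 \<and> x \<le> z \<and> z \<le> y)"
proof
  assume "z \<in> csupp f"
  then obtain \<alpha> x y where z: "z = \<alpha> * x + (1 - \<alpha>) * y" and f: "f x \<noteq> 0" "f y \<noteq> 0"
    and \<alpha>: "0 \<le> \<alpha>" "\<alpha> \<le> 1"
    by (auto simp: csupp_def)
  have "min x y \<le> z" "z \<le> max x y"
    using convex_bound_le[of x "max x y" y \<alpha> "1 - \<alpha>"] convex_bound_le[of "-x" "- min x y" "-y" \<alpha> "1 - \<alpha>"] \<alpha>
    by (simp_all add: z)
  then show "\<exists>x y. f x \<noteq> 0 \<and> f y \<noteq> 0 \<and> x \<le> z \<and> z \<le> y"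
    using f by (metis max_def min_def)
next
  assume "\<exists>x y. f x \<noteq> 0 \<and> f y \<noteq> 0 \<and> x \<le> z \<and> z \<le> y"
  then obtain x y where f: "f x \<noteq> 0" "f y \<noteq> 0" and z: "x \<le> z" "z \<le> y" by blast
  show "z \<in> csupp f"
  proof (cases "x = y")
    case True
    then have "z = 1 *\<^sub>R x + (1 - 1) *\<^sub>R x" using z by simp
    then show ?thesis unfolding csupp_def using f by fastforce
  next
    case False
    define \<alpha> where "\<alpha> = (y - z) / (y - x)"
    have "\<alpha> * (y - x) = y - z" using False by (simp add: \<alpha>_def)
    then have "z = \<alpha> *\<^sub>R x + (1 - \<alpha>) *\<^sub>R y"
      by (simp add: algebra_simps)
    moreover have "\<alpha> \<in> {0..1}"
      using False z by (simp add: \<alpha>_def divide_le_eq_1)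
    ultimately show ?thesis unfolding csupp_def using f by blast
  qed
qed

lemma overlap_upper:
  assumes "finite X" "x \<in> X"
  shows "card {n. n < length fs \<and> x \<in> csupp (fs ! n)} \<le> overlap X fs"
  unfolding overlap_def using assms by (intro cSUP_upper bdd_above_finite) auto

lemma card_active_le:
  assumes "finite X" "x \<in> X"
  shows "card (active fs x) \<le> overlap X fs"
proof -
  have "active fs x \<subseteq> {n. n < length fs \<and> x \<in> csupp (fs ! n)}"
    by (auto simp: active_def csupp_real_iff)
  then have "card (active fs x) \<le> card {n. n < length fs \<and> x \<in> csupp (fs ! n)}"
    by (intro card_mono) auto
  then show ?thesis using overlap_upper[OF assms, of fs] by linarith
qed

definition interacting :: "real set \<Rightarrow> (real \<Rightarrow> real) list \<Rightarrow> (real \<Rightarrow> real) list \<Rightarrow> (nat \<times> nat) set" where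
  "interacting X fs gs = {(n, m). \<exists>x\<in>X. n \<in> active fs x \<and> m \<in> active gs x}"

lemma interacting_subset: "interacting X fs gs \<subseteq> {..<length fs} \<times> {..<length gs}"
  by (auto simp: interacting_def active_def)

text \<open>
  Pairs charged to their first function: the first quadrature point in its convex support also
  lies in the convex support of the second one. Non-emptiness guards against the unspecified
  minimum of the empty set.
\<close>

definition starts_in :: "real set \<Rightarrow> (real \<Rightarrow> real) list \<Rightarrow> (real \<Rightarrow> real) list \<Rightarrow> (nat \<times> nat) set" where
  "starts_in X fs gs = (SIGMA n:{..<length fs}. {m. m < length gs \<and>
     X \<inter> csupp (fs ! n) \<noteq> {} \<and> Min (X \<inter> csupp (fs ! n)) \<in> csupp (gs ! m)})"

text \<open>
  The first function fixes the quadrature point, and at most \<open>overlap X gs\<close> functions of the other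
  family reach that point.
\<close>

lemma card_starts_in_le:
  assumes "finite X"
  shows "card (starts_in X fs gs) \<le> length fs * overlap X gs"
proof -
  have "card {m. m < length gs \<and> Y \<noteq> {} \<and> Min Y \<in> csupp (gs ! m)} \<le> overlap X gs"
    if "Y \<subseteq> X" for Y
  proof (cases "Y = {}")
    case False
    then have "Min Y \<in> X" using that assms Min_in[of Y] finite_subset by blast
    then show ?thesis using overlap_upper[OF assms] False by simp
  qed simp
  then have "(\<Sum>n<length fs. card {m. m < length gs \<and>
     X \<inter> csupp (fs ! n) \<noteq> {} \<and> Min (X \<inter> csupp (fs ! n)) \<in> csupp (gs ! m)}) \<le>
     of_nat (card {..<length fs}) * overlap X gs"
    by (intro sum_bounded_above) simp
  then show ?thesis by (simp add: starts_in_def)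
qed

text \<open>
  Of the two starting points of an interacting pair, the larger one lies between the other one
  and the common point, hence in both convex supports. So every pair is charged to the function
  that starts later.
\<close>

lemma card_interacting_le:
  assumes "finite X"
  shows "card (interacting X fs gs) \<le> overlap X gs * length fs + overlap X fs * length gs"
proof -
  have fin: "finite (starts_in X fs gs)" for fs gs
    by (auto simp: starts_in_def)
  have "interacting X fs gs \<subseteq> starts_in X fs gs \<union> prod.swap ` starts_in X gs fs"
  proof
    fix nm assume "nm \<in> interacting X fs gs"
    then obtain n m x where nm: "nm = (n, m)" "n < length fs" "m < length gs"
      and x: "x \<in> X" "(fs ! n) x \<noteq> 0" "(gs ! m) x \<noteq> 0"
      by (auto simp: interacting_def active_def)
    define I where "I = X \<inter> csupp (fs ! n)"
    define J where "J = X \<inter> csupp (gs ! m)"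
    have xIJ: "x \<in> I" "x \<in> J" using x by (auto simp: I_def J_def csupp_real_iff)
    have fin: "finite I" "finite J" using assms by (auto simp: I_def J_def)
    have le: "Min I \<le> x" "Min J \<le> x" using fin xIJ by auto
    have "Min I \<in> I" "Min J \<in> J" using fin xIJ by (auto intro!: Min_in)
    then have "Min I \<in> csupp (gs ! m) \<or> Min J \<in> csupp (fs ! n)"
      using le xIJ linear[of "Min I" "Min J"] unfolding I_def J_def Int_iff csupp_real_iff
      by (meson order_trans)
    then show "nm \<in> starts_in X fs gs \<union> prod.swap ` starts_in X gs fs"
      using nm xIJ by (force simp: starts_in_def I_def J_def)
  qed
  then have "card (interacting X fs gs) \<le> card (starts_in X fs gs \<union> prod.swap ` starts_in X gs fs)"
    using fin by (intro card_mono) auto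
  also have "\<dots> \<le> card (starts_in X fs gs) + card (prod.swap ` starts_in X gs fs)"
    by (rule card_Un_le)
  also have "\<dots> \<le> length fs * overlap X gs + length gs * overlap X fs"
    using card_starts_in_le[OF assms] card_image_le[OF fin, of prod.swap gs fs]
    by (meson add_mono order_trans)
  finally show ?thesis by (simp add: mult.commute)
qed

text \<open>
  A pair of global indices is determined by its pairs of univariate indices. The injection into
  the product of the sets of interacting pairs is built one direction at a time, since division
  with remainder separates the last index from the others.
\<close>

lemma card_interacting_indices_le:
  "card {(i, j). i < family_size d \<Psi> \<and> j < family_size d \<Phi> \<and>
      (\<forall>\<delta>\<in>{1..d}. (lex_index \<Phi> j \<delta>, lex_index \<Psi> i \<delta>) \<in> interacting (X \<delta>) (\<Phi> \<delta>) (\<Psi> \<delta>))}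
    \<le> (\<Prod>\<delta>=1..d. card (interacting (X \<delta>) (\<Phi> \<delta>) (\<Psi> \<delta>)))"
proof (induction d)
  case 0
  have "{(i, j). i < family_size 0 \<Psi> \<and> j < family_size 0 \<Phi>} = {(0, 0)}" by auto
  then show ?case by simp
next
  case (Suc d)
  define Z where "Z = (\<lambda>d. {(i, j). i < family_size d \<Psi> \<and> j < family_size d \<Phi> \<and>
      (\<forall>\<delta>\<in>{1..d}. (lex_index \<Phi> j \<delta>, lex_index \<Psi> i \<delta>) \<in> interacting (X \<delta>) (\<Phi> \<delta>) (\<Psi> \<delta>))})"
  define I where "I = interacting (X (Suc d)) (\<Phi> (Suc d)) (\<Psi> (Suc d))"
  define split where "split = (\<lambda>(i, j). ((i mod family_size d \<Psi>, j mod family_size d \<Phi>),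
    (j div family_size d \<Phi>, i div family_size d \<Psi>)))"
  have "finite I"
    unfolding I_def using interacting_subset by (rule finite_subset) simp
  moreover have "Z d \<subseteq> {..<family_size d \<Psi>} \<times> {..<family_size d \<Phi>}" by (auto simp: Z_def)
  then have "finite (Z d)" by (rule finite_subset) simp
  moreover have "split ` Z (Suc d) \<subseteq> Z d \<times> I"
  proof (rule image_subsetI)
    fix z assume "z \<in> Z (Suc d)"
    then obtain i j where z: "z = (i, j)" "i < family_size (Suc d) \<Psi>" "j < family_size (Suc d) \<Phi>"
      and int: "\<And>\<delta>. \<delta> \<in> {1..Suc d} \<Longrightarrow>
        (lex_index \<Phi> j \<delta>, lex_index \<Psi> i \<delta>) \<in> interacting (X \<delta>) (\<Phi> \<delta>) (\<Psi> \<delta>)"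
      by (auto simp: Z_def)
    have "(j div family_size d \<Phi>, i div family_size d \<Psi>) \<in> I"
      using int[of "Suc d"] z by (simp add: I_def lex_index_last)
    moreover have "i mod family_size d \<Psi> < family_size d \<Psi>" "j mod family_size d \<Phi> < family_size d \<Phi>"
      using z by (auto simp: family_size_Suc intro!: mod_less_divisor gr0I)
    ultimately show "split z \<in> Z d \<times> I"
      using int by (auto simp: z split_def Z_def lex_index_mod)
  qed
  moreover have "inj_on split (Z (Suc d))"
    by (rule inj_onI) (auto simp: split_def, (metis div_mult_mod_eq)+)
  ultimately have "card (Z (Suc d)) \<le> card (Z d \<times> I)"
    by (metis card_inj_on_le finite_cartesian_product)
  also have "\<dots> \<le> (\<Prod>\<delta>=1..d. card (interacting (X \<delta>) (\<Phi> \<delta>) (\<Psi> \<delta>))) * card I"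
    using Suc.IH by (simp add: card_cartesian_product Z_def)
  finally show ?case by (simp add: Z_def I_def)
qed

definition interaction_bound ::
  "(nat \<Rightarrow> real set) \<Rightarrow> (nat \<Rightarrow> (real \<Rightarrow> real) list) \<Rightarrow> (nat \<Rightarrow> (real \<Rightarrow> real) list) \<Rightarrow> nat \<Rightarrow> nat" where
  "interaction_bound X \<Phi> \<Psi> \<delta> =
     overlap (X \<delta>) (\<Psi> \<delta>) * length (\<Phi> \<delta>) + overlap (X \<delta>) (\<Phi> \<delta>) * length (\<Psi> \<delta>)"

lemma lex_index_less:
  assumes "n < family_size d \<Phi>" "\<delta> \<in> {1..d}"
  shows "lex_index \<Phi> n \<delta> < length (\<Phi> \<delta>)"
proof -
  have "length (\<Phi> \<delta>) \<noteq> 0"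
  proof
    assume "length (\<Phi> \<delta>) = 0"
    then have "family_size d \<Phi> = 0" using assms(2) by (auto simp: family_size_def)
    then show False using assms(1) by simp
  qed
  then show ?thesis by (simp add: lex_index_def)
qed

lemma nnz_system_matrix_le:
  assumes "\<forall>\<delta>\<in>{1..d}. finite (X \<delta>)"
  shows "nnz (system_matrix d X \<omega> \<Phi> \<Psi> F) \<le> (\<Prod>\<delta>=1..d. interaction_bound X \<Phi> \<Psi> \<delta>)"
proof -
  let ?Z = "{(i, j). i < family_size d \<Psi> \<and> j < family_size d \<Phi> \<and>
      (\<forall>\<delta>\<in>{1..d}. (lex_index \<Phi> j \<delta>, lex_index \<Psi> i \<delta>) \<in> interacting (X \<delta>) (\<Phi> \<delta>) (\<Psi> \<delta>))}"
  have "?Z \<subseteq> {..<family_size d \<Psi>} \<times> {..<family_size d \<Phi>}" by auto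
  then have fin: "finite ?Z" by (rule finite_subset) simp
  have "(lex_index \<Phi> j \<delta>, lex_index \<Psi> i \<delta>) \<in> interacting (X \<delta>) (\<Phi> \<delta>) (\<Psi> \<delta>)"
    if ij: "i < family_size d \<Psi>" "j < family_size d \<Phi>" and \<delta>: "\<delta> \<in> {1..d}"
      and nonzero: "quad_form d X \<omega> F (tensor_fun d \<Phi> j) (tensor_fun d \<Psi> i) \<noteq> 0" for i j \<delta>
  proof -
    obtain x where x: "x \<in> PiE {1..d} X" and "tensor_fun d \<Phi> j x \<noteq> 0" "tensor_fun d \<Psi> i x \<noteq> 0"
      using nonzero unfolding quad_form_def by (auto elim!: sum.not_neutral_contains_not_neutral)
    then have "(\<Phi> \<delta> ! lex_index \<Phi> j \<delta>) (x \<delta>) \<noteq> 0" "(\<Psi> \<delta> ! lex_index \<Psi> i \<delta>) (x \<delta>) \<noteq> 0"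
      using \<delta> by (simp_all add: tensor_fun_def)
    moreover have "x \<delta> \<in> X \<delta>" using x \<delta> by (rule PiE_mem)
    ultimately show ?thesis
      using ij \<delta> by (auto simp: interacting_def active_def lex_index_less)
  qed
  then have "nnz (system_matrix d X \<omega> \<Phi> \<Psi> F) \<le> card ?Z"
    unfolding nnz_def using fin by (intro card_mono) (auto simp: system_matrix_def)
  also have "\<dots> \<le> (\<Prod>\<delta>=1..d. card (interacting (X \<delta>) (\<Phi> \<delta>) (\<Psi> \<delta>)))"
    by (rule card_interacting_indices_le)
  also have "\<dots> \<le> (\<Prod>\<delta>=1..d. interaction_bound X \<Phi> \<Psi> \<delta>)"
    unfolding interaction_bound_def using assms by (intro prod_mono) (auto intro: card_interacting_le)
  finally show ?thesis .
qed

section \<open>The cost\<close>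

definition cost_bound ::
  "nat \<Rightarrow> (nat \<Rightarrow> real set) \<Rightarrow> (nat \<Rightarrow> (real \<Rightarrow> real) list) \<Rightarrow> (nat \<Rightarrow> (real \<Rightarrow> real) list) \<Rightarrow> nat" where
  "cost_bound d X \<Phi> \<Psi> =
     (\<Sum>i=1..d. overlap (X i) (\<Phi> i) * overlap (X i) (\<Psi> i) * (\<Prod>\<delta>=i..d. card (X \<delta>)) *
        (\<Prod>\<delta>=1..<i. interaction_bound X \<Phi> \<Psi> \<delta>))"

text \<open>
  The recursion for the cost itself, with the number of active pairs and the number of
  non-zero entries replaced by their upper bounds.
\<close>

lemma cost_bound_Suc:
  "cost_bound (Suc d) X \<Phi> \<Psi> = card (X (Suc d)) * (cost_bound d X \<Phi> \<Psi> +
     overlap (X (Suc d)) (\<Phi> (Suc d)) * overlap (X (Suc d)) (\<Psi> (Suc d)) *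
     (\<Prod>\<delta>=1..d. interaction_bound X \<Phi> \<Psi> \<delta>))"
proof -
  have "(\<Sum>i=1..d. overlap (X i) (\<Phi> i) * overlap (X i) (\<Psi> i) * (\<Prod>\<delta>=i..Suc d. card (X \<delta>)) *
        (\<Prod>\<delta>=1..<i. interaction_bound X \<Phi> \<Psi> \<delta>)) = card (X (Suc d)) * cost_bound d X \<Phi> \<Psi>"
    unfolding cost_bound_def sum_distrib_left by (rule sum.cong) (auto simp: mult_ac)
  then show ?thesis
    by (simp add: cost_bound_def algebra_simps atLeastLessThanSuc_atLeastAtMost)
qed

theorem assembly_cost_le:
  assumes "\<forall>\<delta>\<in>{1..d}. finite (X \<delta>)"
  shows "assembly_cost d X \<omega> \<Phi> \<Psi> F \<le> cost_bound d X \<Phi> \<Psi>"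
  using assms
proof (induction d arbitrary: F)
  case 0
  then show ?case by (simp add: assembly_cost_def)
next
  case (Suc d)
  let ?F = "\<lambda>x y. F (y(Suc d := x))"
  have fin: "\<forall>\<delta>\<in>{1..d}. finite (X \<delta>)" and fin_last: "finite (X (Suc d))"
    using Suc.prems by auto
  have sub: "fst (assemble d X \<omega> \<Phi> \<Psi> F') = system_matrix d X \<omega> \<Phi> \<Psi> F'" for F'
    using assembled_matrix_eq[OF fin] by (simp add: assembled_matrix_def)
  have "assembly_cost (Suc d) X \<omega> \<Phi> \<Psi> F =
    (\<Sum>x\<in>X (Suc d). assembly_cost d X \<omega> \<Phi> \<Psi> (?F x) +
       card (active (\<Phi> (Suc d)) x) * card (active (\<Psi> (Suc d)) x) *
       nnz (system_matrix d X \<omega> \<Phi> \<Psi> (?F x)))"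
    unfolding assembly_cost_def
    by (subst assemble_Suc) (use fin_last in \<open>auto simp: sub, simp add: system_matrix_def\<close>)
  also have "\<dots> \<le> of_nat (card (X (Suc d))) * (cost_bound d X \<Phi> \<Psi> +
     overlap (X (Suc d)) (\<Phi> (Suc d)) * overlap (X (Suc d)) (\<Psi> (Suc d)) *
     (\<Prod>\<delta>=1..d. interaction_bound X \<Phi> \<Psi> \<delta>))"
    using Suc.IH fin fin_last
    by (intro sum_bounded_above add_mono mult_mono card_active_le nnz_system_matrix_le) auto
  finally show ?case by (simp add: cost_bound_Suc)
qed

text \<open>
  In the \<open>i\<close>-th term each direction contributes exactly one factor, the number of points for
  \<open>\<delta> \<ge> i\<close> and the interaction bound for \<open>\<delta> < i\<close>. Since \<open>i \<le> d\<close>, the interaction bound of the last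
  direction never occurs.
\<close>

lemma cost_bound_le:
  fixes u :: "nat \<Rightarrow> real"
  assumes card: "\<And>\<delta>. \<delta> \<in> {1..d} \<Longrightarrow> real (card (X \<delta>)) \<le> u \<delta>"
    and bound: "\<And>\<delta>. \<delta> \<in> {1..<d} \<Longrightarrow> real (interaction_bound X \<Phi> \<Psi> \<delta>) \<le> u \<delta>"
  shows "real (cost_bound d X \<Phi> \<Psi>) \<le>
    real (\<Sum>i=1..d. overlap (X i) (\<Phi> i) * overlap (X i) (\<Psi> i)) * (\<Prod>\<delta>=1..d. u \<delta>)"
proof -
  have "real (\<Prod>\<delta>=i..d. card (X \<delta>)) * real (\<Prod>\<delta>=1..<i. interaction_bound X \<Phi> \<Psi> \<delta>) \<le>
    (\<Prod>\<delta>=1..d. u \<delta>)" if i: "i \<in> {1..d}" for i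
  proof -
    have u: "0 \<le> u \<delta>" if "\<delta> \<in> {1..d}" for \<delta>
      using card[OF that] by linarith
    have "{1..d} = {1..<i} \<union> {i..d}" using i by auto
    then have "(\<Prod>\<delta>=1..d. u \<delta>) = (\<Prod>\<delta>=1..<i. u \<delta>) * (\<Prod>\<delta>=i..d. u \<delta>)"
      by (simp only:) (rule prod.union_disjoint, auto)
    moreover have "real (\<Prod>\<delta>=i..d. card (X \<delta>)) \<le> (\<Prod>\<delta>=i..d. u \<delta>)"
      unfolding of_nat_prod using i card by (intro prod_mono) auto
    moreover have "real (\<Prod>\<delta>=1..<i. interaction_bound X \<Phi> \<Psi> \<delta>) \<le> (\<Prod>\<delta>=1..<i. u \<delta>)"
      unfolding of_nat_prod using i bound by (intro prod_mono) auto
    moreover have "0 \<le> (\<Prod>\<delta>=i..d. u \<delta>)"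
      using i u by (intro prod_nonneg) auto
    ultimately show ?thesis
      by (metis mult.commute mult_mono of_nat_0_le_iff)
  qed
  then show ?thesis
    unfolding cost_bound_def of_nat_sum of_nat_mult sum_distrib_right
    by (intro sum_mono) (simp add: mult.assoc mult_left_mono)
qed

lemma overlap_le_max_overlap:
  assumes "\<delta> \<in> {1..d}"
  shows "overlap (X \<delta>) (\<Phi> \<delta>) \<le> max_overlap d X \<Phi> \<Psi>"
    and "overlap (X \<delta>) (\<Psi> \<delta>) \<le> max_overlap d X \<Phi> \<Psi>"
  unfolding max_overlap_def using assms by (auto intro!: Max_ge)

lemma assembly_cost_le_max_overlap:
  fixes u :: "nat \<Rightarrow> real"
  assumes fin: "\<forall>\<delta>\<in>{1..d}. finite (X \<delta>)"
    and card: "\<And>\<delta>. \<delta> \<in> {1..d} \<Longrightarrow> real (card (X \<delta>)) \<le> u \<delta>"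
    and bound: "\<And>\<delta>. \<delta> \<in> {1..<d} \<Longrightarrow> real (interaction_bound X \<Phi> \<Psi> \<delta>) \<le> u \<delta>"
  shows "real (assembly_cost d X \<omega> \<Phi> \<Psi> F) \<le>
    real d * (real (max_overlap d X \<Phi> \<Psi>))\<^sup>2 * (\<Prod>\<delta>=1..d. u \<delta>)"
proof -
  have "(\<Sum>i=1..d. overlap (X i) (\<Phi> i) * overlap (X i) (\<Psi> i)) \<le>
      of_nat (card {1..d}) * (max_overlap d X \<Phi> \<Psi>)\<^sup>2"
    unfolding power2_eq_square
    by (intro sum_bounded_above mult_mono overlap_le_max_overlap) auto
  then have "real (\<Sum>i=1..d. overlap (X i) (\<Phi> i) * overlap (X i) (\<Psi> i)) \<le>
      real (d * (max_overlap d X \<Phi> \<Psi>)\<^sup>2)"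
    by (simp only: of_nat_le_iff) simp
  moreover have "0 \<le> (\<Prod>\<delta>=1..d. u \<delta>)"
    using card by (intro prod_nonneg) (meson of_nat_0_le_iff order_trans)
  ultimately have "real (\<Sum>i=1..d. overlap (X i) (\<Phi> i) * overlap (X i) (\<Psi> i)) * (\<Prod>\<delta>=1..d. u \<delta>) \<le>
      real (d * (max_overlap d X \<Phi> \<Psi>)\<^sup>2) * (\<Prod>\<delta>=1..d. u \<delta>)"
    by (rule mult_right_mono)
  moreover have "real (assembly_cost d X \<omega> \<Phi> \<Psi> F) \<le> real (cost_bound d X \<Phi> \<Psi>)"
    using assembly_cost_le[OF fin] by simp
  ultimately show ?thesis
    using cost_bound_le[of d X u \<Phi> \<Psi>, OF card bound] by simp
qed

lemma interaction_bound_le: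
  assumes "\<delta> \<in> {1..d}" and "real (length (\<Psi> \<delta>)) \<le> a * real (length (\<Phi> \<delta>))"
  shows "real (interaction_bound X \<Phi> \<Psi> \<delta>) \<le>
    (1 + a) * real (max_overlap d X \<Phi> \<Psi>) * real (length (\<Phi> \<delta>))"
proof -
  let ?P = "max_overlap d X \<Phi> \<Psi>"
  have "interaction_bound X \<Phi> \<Psi> \<delta> \<le> ?P * length (\<Phi> \<delta>) + ?P * length (\<Psi> \<delta>)"
    unfolding interaction_bound_def
    by (intro add_mono mult_right_mono overlap_le_max_overlap assms) auto
  then have "real (interaction_bound X \<Phi> \<Psi> \<delta>) \<le> real (?P * length (\<Phi> \<delta>) + ?P * length (\<Psi> \<delta>))"
    by (simp only: of_nat_le_iff)
  also have "\<dots> \<le> ?P * length (\<Phi> \<delta>) + ?P * (a * length (\<Phi> \<delta>))"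
    using assms(2) by (simp add: mult_left_mono)
  finally show ?thesis by (simp add: algebra_simps)
qed

lemma cost_bound_le_max:
  assumes "d \<ge> 1"
  shows "cost_bound d X \<Phi> \<Psi> \<le> (\<Sum>i=1..d. overlap (X i) (\<Phi> i) * overlap (X i) (\<Psi> i)) *
    card (X d) * (\<Prod>\<delta>=1..<d. max (card (X \<delta>)) (interaction_bound X \<Phi> \<Psi> \<delta>))"
proof -
  define u where "u = (\<lambda>\<delta>. if \<delta> = d then card (X \<delta>)
    else max (card (X \<delta>)) (interaction_bound X \<Phi> \<Psi> \<delta>))"
  have "real (cost_bound d X \<Phi> \<Psi>) \<le>
    real (\<Sum>i=1..d. overlap (X i) (\<Phi> i) * overlap (X i) (\<Psi> i)) * (\<Prod>\<delta>=1..d. real (u \<delta>))"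
    by (rule cost_bound_le) (auto simp: u_def)
  then have "cost_bound d X \<Phi> \<Psi> \<le> (\<Sum>i=1..d. overlap (X i) (\<Phi> i) * overlap (X i) (\<Psi> i)) *
      (\<Prod>\<delta>=1..d. u \<delta>)"
    by (metis of_nat_le_iff of_nat_mult of_nat_prod)
  moreover have "{1..d} = insert d {1..<d}" using assms by auto
  then have "(\<Prod>\<delta>=1..d. u \<delta>) =
      card (X d) * (\<Prod>\<delta>=1..<d. max (card (X \<delta>)) (interaction_bound X \<Phi> \<Psi> \<delta>))"
    by (simp add: u_def)
  ultimately show ?thesis by (simp only: mult.assoc)
qed

text \<open>
  The factor \<open>1 + b\<close> dominates both \<open>1\<close> and \<open>b\<close>, so that one value \<open>u \<delta>\<close> bounds the interactions
  and the points. Each of the \<open>d\<close> directions contributes one power of the overlap, in addition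
  to the two powers from the active pairs.
\<close>

lemma assembly_cost_le_if_points_le_interactions:
  assumes "0 < a" "0 < b" and fin: "\<forall>\<delta>\<in>{1..d}. finite (X \<delta>)"
    and a: "\<forall>\<delta>\<in>{1..d}. real (length (\<Psi> \<delta>)) \<le> a * real (length (\<Phi> \<delta>))"
    and b: "\<forall>\<delta>\<in>{1..d}. real (card (X \<delta>)) \<le> b * real (interaction_bound X \<Phi> \<Psi> \<delta>)"
  shows "real (assembly_cost d X \<omega> \<Phi> \<Psi> F) \<le>
    (real d * ((1 + b) * (1 + a)) ^ d) * real (max_overlap d X \<Phi> \<Psi> ^ (d + 2) * family_size d \<Phi>)"
proof -
  define P where "P = max_overlap d X \<Phi> \<Psi>"
  define u where "u = (\<lambda>\<delta>. ((1 + b) * (1 + a) * P) * real (length (\<Phi> \<delta>)))"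
  have K: "(1 + b) * real (interaction_bound X \<Phi> \<Psi> \<delta>) \<le> u \<delta>" if "\<delta> \<in> {1..d}" for \<delta>
    using mult_left_mono[OF interaction_bound_le[of \<delta> d \<Psi> a \<Phi> X], of "1 + b"] that a \<open>0 < b\<close>
    by (simp add: u_def P_def mult.assoc)
  have "real (assembly_cost d X \<omega> \<Phi> \<Psi> F) \<le> real d * (real P)\<^sup>2 * (\<Prod>\<delta>=1..d. u \<delta>)"
    unfolding P_def
  proof (rule assembly_cost_le_max_overlap[OF fin])
    show "real (card (X \<delta>)) \<le> u \<delta>" if "\<delta> \<in> {1..d}" for \<delta>
      using K[OF that] b[rule_format, OF that] \<open>0 < b\<close> by (simp add: distrib_right)
    show "real (interaction_bound X \<Phi> \<Psi> \<delta>) \<le> u \<delta>" if "\<delta> \<in> {1..<d}" for \<delta>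
    proof -
      have "0 \<le> b * real (interaction_bound X \<Phi> \<Psi> \<delta>)" using \<open>0 < b\<close> by simp
      then show ?thesis using K[of \<delta>] that by (simp add: distrib_right)
    qed
  qed
  also have "\<dots> = (real d * ((1 + b) * (1 + a)) ^ d) * real (P ^ (d + 2) * family_size d \<Phi>)"
    by (simp add: u_def prod.distrib family_size_def power_mult_distrib power_add power2_eq_square)
  finally show ?thesis by (simp only: P_def)
qed

text \<open>
  Here the last direction is bounded without the overlap, which leaves \<open>d - 1\<close> powers from the
  directions and two from the active pairs. Bounding the points in the other directions by a
  multiple of the overlap requires a positive overlap; if it is zero, no function is active and
  the cost vanishes.
\<close>

lemma assembly_cost_le_if_points_le_functions:
  assumes "d \<ge> 1" "0 < a" "0 < b" and fin: "\<forall>\<delta>\<in>{1..d}. finite (X \<delta>)"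
    and a: "\<forall>\<delta>\<in>{1..d}. real (length (\<Psi> \<delta>)) \<le> a * real (length (\<Phi> \<delta>))"
    and b: "\<forall>\<delta>\<in>{1..d}. real (card (X \<delta>)) \<le> b * real (length (\<Phi> \<delta>))"
  shows "real (assembly_cost d X \<omega> \<Phi> \<Psi> F) \<le>
    (real d * (1 + a + b) ^ d) * real (max_overlap d X \<Phi> \<Psi> ^ (d + 1) * family_size d \<Phi>)"
proof (cases "max_overlap d X \<Phi> \<Psi> = 0")
  case True
  have "real (assembly_cost d X \<omega> \<Phi> \<Psi> F) \<le> real d * (real (max_overlap d X \<Phi> \<Psi>))\<^sup>2 *
      (\<Prod>\<delta>=1..d. real (card (X \<delta>) + interaction_bound X \<Phi> \<Psi> \<delta>))"
    by (rule assembly_cost_le_max_overlap[OF fin]) auto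
  then show ?thesis by (simp add: True)
next
  case False
  define P where "P = max_overlap d X \<Phi> \<Psi>"
  then have P: "1 \<le> real P" using False by simp
  define u where "u = (\<lambda>\<delta>. (if \<delta> = d then 1 else real P) * ((1 + a + b) * real (length (\<Phi> \<delta>))))"
  have "real (assembly_cost d X \<omega> \<Phi> \<Psi> F) \<le> real d * (real P)\<^sup>2 * (\<Prod>\<delta>=1..d. u \<delta>)"
    unfolding P_def
  proof (rule assembly_cost_le_max_overlap[OF fin])
    show "real (card (X \<delta>)) \<le> u \<delta>" if "\<delta> \<in> {1..d}" for \<delta>
    proof -
      have "real (card (X \<delta>)) \<le> 1 * ((1 + a + b) * real (length (\<Phi> \<delta>)))"
        using b[rule_format, OF that] \<open>0 < a\<close> by (simp add: distrib_right add_increasing)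
      also have "\<dots> \<le> u \<delta>"
        unfolding u_def using P \<open>0 < a\<close> \<open>0 < b\<close> by (intro mult_right_mono) auto
      finally show ?thesis .
    qed
    show "real (interaction_bound X \<Phi> \<Psi> \<delta>) \<le> u \<delta>" if "\<delta> \<in> {1..<d}" for \<delta>
    proof -
      have "real (interaction_bound X \<Phi> \<Psi> \<delta>) \<le> (1 + a) * real P * real (length (\<Phi> \<delta>))"
        unfolding P_def by (rule interaction_bound_le) (use that a in auto)
      also have "\<dots> \<le> u \<delta>"
        using that \<open>0 < b\<close> by (simp add: u_def algebra_simps)
      finally show ?thesis .
    qed
  qed
  also have "(\<Prod>\<delta>=1..d. u \<delta>) = real P ^ (d - 1) * ((1 + a + b) ^ d * real (family_size d \<Phi>))"
  proof -
    have "{1..d} = insert d {1..<d}" using \<open>d \<ge> 1\<close> by auto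
    then have "(\<Prod>\<delta>=1..d. if \<delta> = d then 1 else real P) = real P ^ (d - 1)"
      by (simp)
    then show ?thesis by (simp add: u_def prod.distrib family_size_def)
  qed
  also have "real d * (real P)\<^sup>2 * \<dots> = (real d * (1 + a + b) ^ d) * real (P ^ (d + 1) * family_size d \<Phi>)"
    using \<open>d \<ge> 1\<close> by (cases d) (simp_all add: power2_eq_square)
  finally show ?thesis by (simp only: P_def)
qed

lemma assembly_cost_le_if_interactions_le_points:
  assumes "0 < b" and fin: "\<forall>\<delta>\<in>{1..d}. finite (X \<delta>)"
    and b: "\<forall>\<delta>\<in>{1..d}. real (interaction_bound X \<Phi> \<Psi> \<delta>) \<le> b * real (card (X \<delta>))"
  shows "real (assembly_cost d X \<omega> \<Phi> \<Psi> F) \<le>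
    (real d * (1 + b) ^ d) * real ((max_overlap d X \<Phi> \<Psi>)\<^sup>2 * card (PiE {1..d} X))"
proof -
  have "real (assembly_cost d X \<omega> \<Phi> \<Psi> F) \<le> real d * (real (max_overlap d X \<Phi> \<Psi>))\<^sup>2 *
      (\<Prod>\<delta>=1..d. (1 + b) * real (card (X \<delta>)))"
  proof (rule assembly_cost_le_max_overlap[OF fin])
    show "real (card (X \<delta>)) \<le> (1 + b) * real (card (X \<delta>))" for \<delta>
      using \<open>0 < b\<close> by (simp add: distrib_right)
    show "real (interaction_bound X \<Phi> \<Psi> \<delta>) \<le> (1 + b) * real (card (X \<delta>))" if "\<delta> \<in> {1..<d}" for \<delta>
      using b[rule_format, of \<delta>] that by (simp add: distrib_right)
  qed
  then show ?thesis
    by (simp add: prod.distrib card_PiE mult_ac)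
qed

theorem mainTheorem1:
  fixes d :: nat
  assumes "d \<ge> 1"
  shows
    "(\<exists>c>0. \<forall>(X :: nat \<Rightarrow> real set) (\<omega> :: nat \<Rightarrow> real \<Rightarrow> real) (\<Phi> :: nat \<Rightarrow> (real \<Rightarrow> real) list)
        (\<Psi> :: nat \<Rightarrow> (real \<Rightarrow> real) list) (F :: (nat \<Rightarrow> real) \<Rightarrow> real).
        (\<forall>\<delta>\<in>{1..d}. finite (X \<delta>)) \<longrightarrow>
        (let N = (\<lambda>\<delta>. length (\<Phi> \<delta>)); M = (\<lambda>\<delta>. length (\<Psi> \<delta>));
             p = (\<lambda>\<delta>. overlap (X \<delta>) (\<Phi> \<delta>)); q = (\<lambda>\<delta>. overlap (X \<delta>) (\<Psi> \<delta>));
             S = (\<Sum>i=1..d. p i * q i * (\<Prod>\<delta>=i..d. card (X \<delta>)) *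
                    (\<Prod>\<delta>=1..<i. q \<delta> * N \<delta> + p \<delta> * M \<delta>))
         in assembled_matrix d X \<omega> \<Phi> \<Psi> F = system_matrix d X \<omega> \<Phi> \<Psi> F \<and>
            real (assembly_cost d X \<omega> \<Phi> \<Psi> F) \<le> c * real S \<and>
            S \<le> (\<Sum>i=1..d. p i * q i) * card (X d) *
                  (\<Prod>\<delta>=1..<d. max (card (X \<delta>)) (q \<delta> * N \<delta> + p \<delta> * M \<delta>)))) \<and>
     (\<forall>a>0. \<forall>b>0. \<exists>c>0. \<forall>(X :: nat \<Rightarrow> real set) (\<omega> :: nat \<Rightarrow> real \<Rightarrow> real)
        (\<Phi> :: nat \<Rightarrow> (real \<Rightarrow> real) list) (\<Psi> :: nat \<Rightarrow> (real \<Rightarrow> real) list) (F :: (nat \<Rightarrow> real) \<Rightarrow> real).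
        (\<forall>\<delta>\<in>{1..d}. finite (X \<delta>)) \<longrightarrow>
        (\<forall>\<delta>\<in>{1..d}. real (length (\<Psi> \<delta>)) \<le> a * real (length (\<Phi> \<delta>))) \<longrightarrow>
        (\<forall>\<delta>\<in>{1..d}. real (card (X \<delta>)) \<le> b * real (overlap (X \<delta>) (\<Psi> \<delta>) * length (\<Phi> \<delta>)
            + overlap (X \<delta>) (\<Phi> \<delta>) * length (\<Psi> \<delta>))) \<longrightarrow>
        real (assembly_cost d X \<omega> \<Phi> \<Psi> F) \<le> c * real (max_overlap d X \<Phi> \<Psi> ^ (d + 2) * family_size d \<Phi>)) \<and>
     (\<forall>a>0. \<forall>b>0. \<exists>c>0. \<forall>(X :: nat \<Rightarrow> real set) (\<omega> :: nat \<Rightarrow> real \<Rightarrow> real)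
        (\<Phi> :: nat \<Rightarrow> (real \<Rightarrow> real) list) (\<Psi> :: nat \<Rightarrow> (real \<Rightarrow> real) list) (F :: (nat \<Rightarrow> real) \<Rightarrow> real).
        (\<forall>\<delta>\<in>{1..d}. finite (X \<delta>)) \<longrightarrow>
        (\<forall>\<delta>\<in>{1..d}. real (length (\<Psi> \<delta>)) \<le> a * real (length (\<Phi> \<delta>))) \<longrightarrow>
        (\<forall>\<delta>\<in>{1..d}. real (card (X \<delta>)) \<le> b * real (length (\<Phi> \<delta>))) \<longrightarrow>
        real (assembly_cost d X \<omega> \<Phi> \<Psi> F) \<le> c * real (max_overlap d X \<Phi> \<Psi> ^ (d + 1) * family_size d \<Phi>)) \<and>
     (\<forall>a>0. \<forall>b>0. \<exists>c>0. \<forall>(X :: nat \<Rightarrow> real set) (\<omega> :: nat \<Rightarrow> real \<Rightarrow> real)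
        (\<Phi> :: nat \<Rightarrow> (real \<Rightarrow> real) list) (\<Psi> :: nat \<Rightarrow> (real \<Rightarrow> real) list) (F :: (nat \<Rightarrow> real) \<Rightarrow> real).
        (\<forall>\<delta>\<in>{1..d}. finite (X \<delta>)) \<longrightarrow>
        (\<forall>\<delta>\<in>{1..d}. real (length (\<Psi> \<delta>)) \<le> a * real (length (\<Phi> \<delta>))) \<longrightarrow>
        (\<forall>\<delta>\<in>{1..d}. real (overlap (X \<delta>) (\<Psi> \<delta>) * length (\<Phi> \<delta>)
            + overlap (X \<delta>) (\<Phi> \<delta>) * length (\<Psi> \<delta>)) \<le> b * real (card (X \<delta>))) \<longrightarrow>
        real (assembly_cost d X \<omega> \<Phi> \<Psi> F) \<le> c * real ((max_overlap d X \<Phi> \<Psi>)\<^sup>2 * card (PiE {1..d} X)))"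
proof (intro conjI allI impI, goal_cases)
  case 1
  show ?case
    by (intro exI[of _ 1] conjI allI impI, simp)
      (use assembled_matrix_eq assembly_cost_le cost_bound_le_max[OF assms] in
        \<open>simp add: Let_def cost_bound_def interaction_bound_def\<close>)
next
  case (2 a b)
  then have "0 < real d * ((1 + b) * (1 + a)) ^ d" using assms by simp
  then show ?case
    using assembly_cost_le_if_points_le_interactions[OF 2, unfolded interaction_bound_def]
    by (intro exI[of _ "real d * ((1 + b) * (1 + a)) ^ d"] conjI allI impI) assumption+
next
  case (3 a b)
  then have "0 < real d * (1 + a + b) ^ d" using assms by simp
  then show ?case
    using assembly_cost_le_if_points_le_functions[OF assms 3]
    by (intro exI[of _ "real d * (1 + a + b) ^ d"] conjI allI impI) assumption+
next
  case (4 a b)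
  then have "0 < real d * (1 + b) ^ d" using assms by simp
  then show ?case
    using assembly_cost_le_if_interactions_le_points[OF 4(2), unfolded interaction_bound_def]
    by (intro exI[of _ "real d * (1 + b) ^ d"] conjI allI impI) assumption+
qed

end
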